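(* Let $\mathcal{X}$ be a finite set, let $\pi$ be a probability measure on $\mathcal{X}$ with strictly positive masses, let $P\in\mathcal{S}(\pi)$, and let $\mathcal{X}=\bigsqcup_{i=1}^k\mathcal{O}_i$ be any partition of $\mathcal{X}$ into non-empty sets, with associated Gibbs kernel $G$ and projection chain $\overline{P}$. Then for every $l\in\mathbb{N}$, $$D_{\mathrm{KL}}^\pi\left((GPG)^l\,\|\,\Pi\right)=D_{\mathrm{KL}}^{\overline{\pi}}\left(\overline{P}^l\,\|\,\overline{\Pi}\right).$$
   Context: $\mathbb{N}=\{1,2,\dots\}$. $\mathcal{S}(\pi)$ is the set of transition (row-stochastic) matrices $P$ on $\mathcal{X}$ with $\pi P=\pi$. The Gibbs kernel $G$ of the partition $(\mathcal{O}_i)_{i=1}^k$ is $G(x,y)=\pi(y)/\pi(\mathcal{O}(x))$ if $y\in\mathcal{O}(x)$ and $G(x,y)=0$ otherwise, where $\mathcal{O}(x)$ is the block containing $x$ and $\pi(A)=\sum_{z\in A}\pi(z)$. $\Pi$ is the transition matrix on $\mathcal{X}$ all of whose rows equal $\pi$. The projection chain is the $k\times k$ transition matrix $\overline{P}(i,j)=\frac{1}{\pi(\mathcal{O}_i)}\sum_{x\in\mathcal{O}_i,\,y\in\mathcal{O}_j}\pi(x)P(x,y)$; it has stationary distribution $\overline{\pi}=(\pi(\mathcal{O}_1),\dots,\pi(\mathcal{O}_k))$, and $\overline{\Pi}$ is the $k\times k$ matrix all of whose rows equal $\overline{\pi}$. For a strictly positive probability measure $\mu$ on a finite set and $\mu$-stationary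 transition matrices $A,B$ on that set, $D^\mu_{\mathrm{KL}}(A\|B)=\sum_{x,y}\mu(x)A(x,y)\log\frac{A(x,y)}{B(x,y)}$, with the convention $0\log(0/a)=0$. *)

theory Defs
  imports "HOL-Analysis.Analysis"
begin

text \<open>
  A finite state space is a type of class \<open>finite\<close>, measures on it are vectors, and kernels are
  square matrices acting on measures from the right (\<open>\<pi> v* P\<close>), with \<open>P $ x $ y\<close> the
  probability of moving from \<open>x\<close> to \<open>y\<close>.
\<close>

definition positive_prob :: "real ^ 'x::finite \<Rightarrow> bool"
  where "positive_prob \<mu> \<longleftrightarrow> (\<forall>x. 0 < \<mu> $ x) \<and> (\<Sum>x\<in>UNIV. \<mu> $ x) = 1"

definition measure_of_set :: "real ^ 'x::finite \<Rightarrow> 'x set \<Rightarrow> real"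
  where "measure_of_set \<mu> A = (\<Sum>z\<in>A. \<mu> $ z)"

definition transition_matrix :: "real ^ 'x ^ 'x::finite \<Rightarrow> bool"
  where "transition_matrix P \<longleftrightarrow>
    (\<forall>x y. 0 \<le> P $ x $ y) \<and> (\<forall>x. (\<Sum>y\<in>UNIV. P $ x $ y) = 1)"

definition stationary_matrices :: "real ^ 'x::finite \<Rightarrow> (real ^ 'x ^ 'x) set"
  where "stationary_matrices \<mu> = {P. transition_matrix P \<and> \<mu> v* P = \<mu>}"

text \<open>
  Powers for the matrix product. The overloaded \<open>^\<close> and \<open>*\<close> on vectors are
  componentwise, hence unusable here.
\<close>

primrec matrix_power :: "real ^ 'x ^ 'x::finite \<Rightarrow> nat \<Rightarrow> real ^ 'x ^ 'x"
  where
    "matrix_power A 0 = mat 1"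
  | "matrix_power A (Suc n) = matrix_power A n ** A"

text \<open>
  A partition into \<open>k\<close> blocks is a family indexed by a finite type with \<open>k\<close> elements, so that
  the projection chain is again a matrix over a finite type.
\<close>

definition indexed_partition :: "('k::finite \<Rightarrow> 'x::finite set) \<Rightarrow> bool"
  where "indexed_partition \<O> \<longleftrightarrow>
    (\<forall>i. \<O> i \<noteq> {}) \<and> disjoint_family \<O> \<and> (\<Union>i. \<O> i) = UNIV"

definition block_containing :: "('k::finite \<Rightarrow> 'x::finite set) \<Rightarrow> 'x \<Rightarrow> 'x set"
  where "block_containing \<O> x = \<O> (THE i. x \<in> \<O> i)"

definition gibbs_kernel ::
    "real ^ 'x::finite \<Rightarrow> ('k::finite \<Rightarrow> 'x set) \<Rightarrow> real ^ 'x ^ 'x"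
  where "gibbs_kernel \<pi> \<O> =
    (\<chi> x y. if y \<in> block_containing \<O> x
            then \<pi> $ y / measure_of_set \<pi> (block_containing \<O> x) else 0)"

definition projected_measure ::
    "real ^ 'x::finite \<Rightarrow> ('k::finite \<Rightarrow> 'x set) \<Rightarrow> real ^ 'k"
  where "projected_measure \<pi> \<O> = (\<chi> i. measure_of_set \<pi> (\<O> i))"

definition projection_chain ::
    "real ^ 'x::finite \<Rightarrow> ('k::finite \<Rightarrow> 'x set) \<Rightarrow> real ^ 'x ^ 'x \<Rightarrow> real ^ 'k ^ 'k"
  where "projection_chain \<pi> \<O> P =
    (\<chi> i j. 1 / measure_of_set \<pi> (\<O> i) * (\<Sum>x\<in>\<O> i. \<Sum>y\<in>\<O> j. \<pi> $ x * P $ x $ y))"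

definition constant_rows :: "real ^ 'x::finite \<Rightarrow> real ^ 'x ^ 'x"
  where "constant_rows \<mu> = (\<chi> x. \<mu>)"

text \<open>
  The convention \<open>0 log (0 / a) = 0\<close> holds because the factor \<open>A $ x $ y\<close> vanishes. The value is
  meaningful only if \<open>A $ x $ y = 0\<close> whenever \<open>B $ x $ y = 0\<close> (otherwise the divergence
  would be infinite); in particular it is for \<open>B = constant_rows \<mu>\<close> with \<open>\<mu>\<close> positive.
\<close>

definition KL_matrix ::
    "real ^ 'x::finite \<Rightarrow> real ^ 'x ^ 'x \<Rightarrow> real ^ 'x ^ 'x \<Rightarrow> real"
  where "KL_matrix \<mu> A B =
    (\<Sum>x\<in>UNIV. \<Sum>y\<in>UNIV. \<mu> $ x * A $ x $ y * ln (A $ x $ y / B $ x $ y))"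

end

theory Submission
  imports Defs
begin

text \<open>
  A kernel \<open>M\<close> on blocks lifts to the kernel on states that moves between blocks by \<open>M\<close> and then
  draws the state inside the new block from \<open>\<pi>\<close>. Lifting is multiplicative, the lift of
  the projection chain is \<open>GPG\<close>, and in the divergence from \<open>\<Pi>\<close> the conditional law inside the
  new block cancels in the logarithm.
\<close>

definition block_index :: "('k::finite \<Rightarrow> 'x::finite set) \<Rightarrow> 'x \<Rightarrow> 'k"
  where "block_index \<O> x = (THE i. x \<in> \<O> i)"

definition lift_kernel ::
    "real ^ 'x::finite \<Rightarrow> ('k::finite \<Rightarrow> 'x set) \<Rightarrow> real ^ 'k ^ 'k \<Rightarrow> real ^ 'x ^ 'x"
  where "lift_kernel \<pi> \<O> M =
    (\<chi> x y. M $ block_index \<O> x $ block_index \<O> y * \<pi> $ y /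
             measure_of_set \<pi> (\<O> (block_index \<O> y)))"

text \<open>Disjointness makes the index in \<open>THE\<close> unique and covering makes it exist.
  The direction from membership to index turns \<open>block_index\<close> into a constant on each
  block once sums are split by \<open>sum_blocks\<close>.\<close>

lemma block_index_eq_iff:
  assumes "indexed_partition \<O>"
  shows "block_index \<O> x = i \<longleftrightarrow> x \<in> \<O> i"
proof -
  have index: "block_index \<O> x = j" if "x \<in> \<O> j" for j
    unfolding block_index_def
  proof (rule the_equality)
    show "i = j" if "x \<in> \<O> i" for i
    proof (rule ccontr)
      assume "i \<noteq> j"
      then have "\<O> i \<inter> \<O> j = {}"
        using assms by (simp add: indexed_partition_def disjoint_family_on_def)
      then show False
        using \<open>x \<in> \<O> i\<close> \<open>x \<in> \<O> j\<close> by blast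
    qed
  qed (fact that)
  obtain j where j: "x \<in> \<O> j"
    using assms unfolding indexed_partition_def by blast
  show ?thesis
  proof
    assume "block_index \<O> x = i"
    then show "x \<in> \<O> i"
      using index[OF j] j by simp
  qed (rule index)
qed

lemma sum_blocks:
  fixes f :: "'x::finite \<Rightarrow> real"
  assumes "indexed_partition \<O>"
  shows "(\<Sum>x\<in>UNIV. f x) = (\<Sum>i\<in>UNIV. \<Sum>x\<in>\<O> i. f x)"
proof -
  have "sum f (\<Union>i. \<O> i) = (\<Sum>i\<in>UNIV. \<Sum>x\<in>\<O> i. f x)"
    using assms unfolding indexed_partition_def disjoint_family_on_def
    by (intro sum.UNION_disjoint) auto
  then show ?thesis
    using assms by (simp add: indexed_partition_def)
qed

lemma measure_of_block_pos:
  assumes "positive_prob \<pi>" "indexed_partition \<O>"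
  shows "0 < measure_of_set \<pi> (\<O> i)"
  using assms unfolding positive_prob_def indexed_partition_def measure_of_set_def
  by (intro sum_pos) auto

text \<open>The left factor depends on the intermediate state \<open>z\<close> through its block and
  the conditional mass of \<open>z\<close> there, the right factor only through the block.
  Conditional masses sum to one in each block, so only the sum over intermediate blocks
  remains.\<close>

lemma lift_kernel_mult:
  assumes "positive_prob \<pi>" "indexed_partition \<O>"
  shows "lift_kernel \<pi> \<O> M ** lift_kernel \<pi> \<O> N = lift_kernel \<pi> \<O> (M ** N)"
proof -
  let ?b = "block_index \<O>" and ?m = "\<lambda>i. measure_of_set \<pi> (\<O> i)"
  have "(\<Sum>z\<in>UNIV. M $ i $ ?b z * \<pi> $ z / ?m (?b z) * (N $ ?b z $ j * \<pi> $ y / ?m j))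
      = (\<Sum>h\<in>UNIV. M $ i $ h * N $ h $ j) * \<pi> $ y / ?m j" (is "?l = _") for i j y
  proof -
    have "?l = (\<Sum>h\<in>UNIV. \<Sum>z\<in>\<O> h. M $ i $ h * \<pi> $ z / ?m h * (N $ h $ j * \<pi> $ y / ?m j))"
      unfolding sum_blocks[OF assms(2)]
      by (intro sum.cong refl) (simp add: block_index_eq_iff[OF assms(2), THEN iffD2])
    also have "\<dots> = (\<Sum>h\<in>UNIV. (\<Sum>z\<in>\<O> h. \<pi> $ z) * (M $ i $ h / ?m h * (N $ h $ j * \<pi> $ y / ?m j)))"
      unfolding sum_distrib_right by (intro sum.cong refl) (simp add: mult_ac)
    \<comment> \<open>The inner sum is \<open>?m h\<close>, which is positive and cancels the
      denominator.\<close>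
    also have "\<dots> = (\<Sum>h\<in>UNIV. M $ i $ h * N $ h $ j * (\<pi> $ y / ?m j))"
    proof (intro sum.cong refl)
      fix h
      show "(\<Sum>z\<in>\<O> h. \<pi> $ z) * (M $ i $ h / ?m h * (N $ h $ j * \<pi> $ y / ?m j))
          = M $ i $ h * N $ h $ j * (\<pi> $ y / ?m j)"
        using measure_of_block_pos[OF assms, of h] by (simp add: measure_of_set_def)
    qed
    finally show ?thesis
      by (simp add: sum_distrib_right sum_divide_distrib)
  qed
  then show ?thesis
    by (simp add: lift_kernel_def matrix_matrix_mult_def vec_eq_iff)
qed

text \<open>Exponents start at one because lifting does not preserve the unit: the lift of
  \<open>mat 1\<close> is the Gibbs kernel.\<close>

lemma matrix_power_lift_kernel:
  assumes "positive_prob \<pi>" "indexed_partition \<O>"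
  shows "matrix_power (lift_kernel \<pi> \<O> M) (Suc n) = lift_kernel \<pi> \<O> (matrix_power M (Suc n))"
  using assms by (induction n) (simp_all add: lift_kernel_mult)

text \<open>The first Gibbs step averages the rows of \<open>P\<close> over the block of
  \<open>x\<close> with weights from \<pi>. The last one collects the mass arriving in the block of
  \<open>y\<close> and redistributes it there by \<pi>. The block-to-block mass in between is the
  entry of the projection chain.\<close>

lemma gibbs_sandwich_eq_lift_kernel:
  assumes "indexed_partition \<O>"
  shows "gibbs_kernel \<pi> \<O> ** P ** gibbs_kernel \<pi> \<O> = lift_kernel \<pi> \<O> (projection_chain \<pi> \<O> P)"
proof -
  let ?b = "block_index \<O>" and ?m = "\<lambda>i. measure_of_set \<pi> (\<O> i)"
  have G: "gibbs_kernel \<pi> \<O> $ x $ y = (if y \<in> \<O> (?b x) then \<pi> $ y / ?m (?b x) else 0)" for x y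
    by (simp add: gibbs_kernel_def block_containing_def block_index_def)
  \<comment> \<open>Lying in the same block is symmetric. In this form the condition restricts the
    row index to a fixed block, as needed when summing over the row of the right-hand Gibbs
    factor.\<close>
  have G': "gibbs_kernel \<pi> \<O> $ x $ y = (if x \<in> \<O> (?b y) then \<pi> $ y / ?m (?b y) else 0)" for x y
    unfolding G using block_index_eq_iff[OF assms] by metis
  have GP: "(gibbs_kernel \<pi> \<O> ** P) $ x $ z = (\<Sum>w\<in>\<O> (?b x). \<pi> $ w * P $ w $ z) / ?m (?b x)" for x z
    by (simp add: matrix_matrix_mult_def G if_distrib[of "\<lambda>t. t * _"] sum.If_cases sum_divide_distrib
        cong: if_cong)
  have "(gibbs_kernel \<pi> \<O> ** P ** gibbs_kernel \<pi> \<O>) $ x $ y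
      = lift_kernel \<pi> \<O> (projection_chain \<pi> \<O> P) $ x $ y" for x y
  proof -
    have "(gibbs_kernel \<pi> \<O> ** P ** gibbs_kernel \<pi> \<O>) $ x $ y
        = (\<Sum>z\<in>UNIV. (gibbs_kernel \<pi> \<O> ** P) $ x $ z * gibbs_kernel \<pi> \<O> $ z $ y)"
      by (simp add: matrix_matrix_mult_def)
    also have "\<dots> = (\<Sum>z\<in>\<O> (?b y). (gibbs_kernel \<pi> \<O> ** P) $ x $ z * (\<pi> $ y / ?m (?b y)))"
      by (simp add: G' if_distrib[of "\<lambda>t. _ * t"] sum.If_cases cong: if_cong)
    also have "\<dots> = (\<Sum>z\<in>\<O> (?b y). \<Sum>w\<in>\<O> (?b x). \<pi> $ w * P $ w $ z) / ?m (?b x)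
        * (\<pi> $ y / ?m (?b y))"
      unfolding GP by (simp add: sum_distrib_right[symmetric] sum_divide_distrib[symmetric])
    also have "(\<Sum>z\<in>\<O> (?b y). \<Sum>w\<in>\<O> (?b x). \<pi> $ w * P $ w $ z)
        = (\<Sum>w\<in>\<O> (?b x). \<Sum>z\<in>\<O> (?b y). \<pi> $ w * P $ w $ z)"
      by (rule sum.swap)
    finally show ?thesis
      by (simp add: lift_kernel_def projection_chain_def)
  qed
  then show ?thesis
    by (simp add: vec_eq_iff)
qed

lemma KL_matrix_lift_kernel:
  assumes "positive_prob \<pi>" "indexed_partition \<O>"
  shows "KL_matrix \<pi> (lift_kernel \<pi> \<O> M) (constant_rows \<pi>)
       = KL_matrix (projected_measure \<pi> \<O>) M (constant_rows (projected_measure \<pi> \<O>))"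
proof -
  let ?b = "block_index \<O>" and ?m = "\<lambda>i. measure_of_set \<pi> (\<O> i)"
  \<comment> \<open>\<open>F\<close> is the part of the summand that depends on the blocks alone.
    The factor \<open>\<pi> $ y\<close> cancels inside the argument of \<open>ln\<close>, so a zero
    entry of \<open>M\<close> needs no separate case.\<close>
  define F where "F i j = M $ i $ j * ln (M $ i $ j / ?m j)" for i j
  have [simp]: "\<pi> $ y \<noteq> 0" "?m i \<noteq> 0" for y i
    using assms(1) measure_of_block_pos[OF assms] unfolding positive_prob_def
    by (metis less_irrefl)+
  have "KL_matrix \<pi> (lift_kernel \<pi> \<O> M) (constant_rows \<pi>)
      = (\<Sum>x\<in>UNIV. \<Sum>y\<in>UNIV. \<pi> $ x * (\<pi> $ y / ?m (?b y) * F (?b x) (?b y)))"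
    unfolding KL_matrix_def lift_kernel_def constant_rows_def F_def
    by (intro sum.cong refl) simp
  also have "\<dots> = (\<Sum>i\<in>UNIV. \<Sum>x\<in>\<O> i. \<Sum>j\<in>UNIV. \<Sum>y\<in>\<O> j. \<pi> $ x * (\<pi> $ y / ?m j * F i j))"
    unfolding sum_blocks[OF assms(2)]
    by (intro sum.cong refl) (simp add: block_index_eq_iff[OF assms(2), THEN iffD2])
  \<comment> \<open>The conditional masses of \<open>y\<close> in block \<open>j\<close> sum to one;
    the masses of \<open>x\<close> then add up to \<open>?m i\<close> in the next step.\<close>
  also have "\<dots> = (\<Sum>i\<in>UNIV. \<Sum>x\<in>\<O> i. \<Sum>j\<in>UNIV. \<pi> $ x * F i j)"
  proof (intro sum.cong refl)
    fix i x j
    have "(\<Sum>y\<in>\<O> j. \<pi> $ x * (\<pi> $ y / ?m j * F i j)) = (\<Sum>y\<in>\<O> j. \<pi> $ y) * (\<pi> $ x * F i j / ?m j)"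
      unfolding sum_distrib_right by (intro sum.cong refl) (simp add: mult_ac)
    then show "(\<Sum>y\<in>\<O> j. \<pi> $ x * (\<pi> $ y / ?m j * F i j)) = \<pi> $ x * F i j"
      by (simp add: measure_of_set_def[symmetric])
  qed
  also have "\<dots> = (\<Sum>i\<in>UNIV. \<Sum>j\<in>UNIV. ?m i * F i j)"
    unfolding measure_of_set_def sum_distrib_right by (intro sum.cong refl sum.swap)
  finally show ?thesis
    by (simp add: KL_matrix_def projected_measure_def constant_rows_def F_def mult.assoc)
qed

theorem proposition3p2:
  fixes \<pi> :: "real ^ 'x::finite"
    and P :: "real ^ 'x ^ 'x"
    and \<O> :: "'k::finite \<Rightarrow> 'x set"
    and l :: nat
  assumes "positive_prob \<pi>"
    and "P \<in> stationary_matrices \<pi>"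
    and "indexed_partition \<O>"
    and "l \<ge> 1"
  shows "KL_matrix \<pi>
           (matrix_power (gibbs_kernel \<pi> \<O> ** P ** gibbs_kernel \<pi> \<O>) l)
           (constant_rows \<pi>)
       = KL_matrix (projected_measure \<pi> \<O>)
           (matrix_power (projection_chain \<pi> \<O> P) l)
           (constant_rows (projected_measure \<pi> \<O>))"
proof -
  \<comment> \<open>The case \<open>l = 0\<close> must be excluded, since
    \<open>matrix_power\<close> then gives \<open>mat 1\<close>, which is not in general a
    lift.\<close>
  obtain n where "l = Suc n"
    using assms(4) by (cases l) auto
  then show ?thesis
    using assms(1,3) gibbs_sandwich_eq_lift_kernel[of \<O> \<pi> P]
      matrix_power_lift_kernel[of \<pi> \<O> "projection_chain \<pi> \<O> P" n]
    by (simp only: KL_matrix_lift_kernel)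
qed

end
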